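(* Let $N$ be a finite non-empty set. The following conditions on supermodular games $m,r\in\lozenge(N)$ are equivalent: (i) $\mathsf{F}(m)\subseteq\mathsf{F}(r)$, where $\mathsf{F}(w)$ denotes the smallest face of the cone $\lozenge(N)$ containing $w$; (ii) either $m=r$ or there exists $q\in\lozenge(N)$ such that $r\in\,]m,q[$; (iii) there exist $q\in\lozenge(N)$ and $\alpha\in(0,1)$ such that $C(r)=(1-\alpha)\cdot C(m)\oplus\alpha\cdot C(q)$; (iv) the normal fan $\mathcal{N}_{C(r)}$ refines the normal fan $\mathcal{N}_{C(m)}$; (v) the enumeration partition $\mathbf{\Upsilon}(r)$ refines $\mathbf{\Upsilon}(m)$, i.e. for every $S\in\mathbf{\Upsilon}(r)$ there is $T\in\mathbf{\Upsilon}(m)$ with $S\subseteq T$; (vi) the tightness structure $\mathbb{T}(r)$ refines $\mathbb{T}(m)$, i.e. for every $\mathcal{T}\in\mathbb{T}(r)$ there is $\mathcal{S}\in\mathbb{T}(m)$ with $\mathcal{T}\subseteq\mathcal{S}$; (vii) $\mathcal{I}(r)\subseteq\mathcal{I}(m)$, that is, $\Delta r(a,b|C)=0$ implies $\Delta m(a,b|C)=0$ for every $(a,b|C)\in\mathcal{E}(N)$; (viii) the permutohedral subgraph $G(r)$ is a subgraph of $G(m)$; (ix) the fan of posets $\mathfrak{F}(m)$ is sparser than $\mathfrak{F}(r)$, i.e. for every $R\in\mathfrak{F}(r)$ there is $Q\in\mathfrak{F}(m)$ with $Q\subseteq R$.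
   Context: $N$ is a finite non-empty set, $n=|N|$, $\mathcal{P}(N)$ its power set, $[n]=\{1,\dots,n\}$. An enumeration of $N$ is a bijection $\varepsilon:[n]\to N$; $\Upsilon(N)$ is the set of enumerations; $\varepsilon_{-1}:N\to[n]$ is the inverse of $\varepsilon$. Write $u\preceq_\varepsilon v$ if $\varepsilon_{-1}(u)\le\varepsilon_{-1}(v)$. A game over $N$ is a function $w:\mathcal{P}(N)\to\mathbb{R}$ with $w(\emptyset)=0$; it is supermodular if $w(D\cup E)+w(D\cap E)\ge w(D)+w(E)$ for all $D,E\subseteq N$. $\lozenge(N)\subseteq\mathbb{R}^{\mathcal{P}(N)}$ is the polyhedral cone of supermodular games over $N$. $]x,y[\,=\{(1-\alpha)x+\alpha y:0<\alpha<1\}$ is the open segment between distinct $x,y$. $\oplus$ is Minkowski sum. The core of $w\in\lozenge(N)$ is the polytope $C(w)=\{z\in\mathbb{R}^N:\sum_{\ell\in N}z_\ell=w(N),\ \sum_{\ell\in S}z_\ell\ge w(S)\ \forall S\subseteq N\}$; $\mathrm{ext}(P)$ denotes the set of vertices of a polytope $P$. For a non-empty polytope $P\subseteq\mathbb{R}^N$ and $y\in P$, the outer normal cone is $\mathsf{N}_P(y)=\{x\in\mathbb{R}^N:\langle x,y-z\rangle\ge0\ \forall z\in P\}$, and the normal fan is $\mathcal{N}_P=\{\mathsf{N}_P(y):y\in P\}$. A complete fan $\mathcal{F}_1$ refines a complete fan $\mathcal{F}_2$ if every cone in $\mathcal{F}_1$ is contained in some cone in $\mathcal{F}_2$. The marginal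 vector of a game $w$ at $\varepsilon\in\Upsilon(N)$ is $\varphi^w(\varepsilon)\in\mathbb{R}^N$ with $\varphi^w(\varepsilon)_{\varepsilon(i)}=w(\{\varepsilon(1),\dots,\varepsilon(i)\})-w(\{\varepsilon(1),\dots,\varepsilon(i-1)\})$ for $i\in[n]$; $\varphi^w_{-1}(\{y\})=\{\varepsilon\in\Upsilon(N):\varphi^w(\varepsilon)=y\}$. The tightness class is $\mathcal{T}^w_y=\{S\subseteq N:\sum_{\ell\in S}y_\ell=w(S)\}$. For $S\subseteq\Upsilon(N)$ put $S^{\rhd}=\{(u,v)\in N\times N:u\preceq_\varepsilon v\ \forall\varepsilon\in S\}$. $\mathcal{E}(N)$ is the set of elementary triplets $(a,b|C)$ with $a,b\in N$ distinct and $C\subseteq N\setminus\{a,b\}$, and $\Delta w(a,b|C)=w(C\cup\{a,b\})+w(C)-w(C\cup\{a\})-w(C\cup\{b\})$. For $w\in\lozenge(N)$ define: - enumeration partition $\mathbf{\Upsilon}(w)=\{\varphi^w_{-1}(\{y\}):y\in\mathrm{ext}(C(w))\}$ (a partition of $\Upsilon(N)$); - fan of posets $\mathfrak{F}(w)=\{(\varphi^w_{-1}(\{y\}))^{\rhd}:y\in\mathrm{ext}(C(w))\}$; - tightness structure $\mathbb{T}(w)=\{\mathcal{T}^w_y:y\in\mathrm{ext}(C(w))\}$; - independence structure $\mathcal{I}(w)=\{(a,b|C)\in\mathcal{E}(N):\Delta w(a,b|C)=0\}$; - permutohedral subgraph $G(w)$: the undirected graph with node set $\Upsilon(N)$ in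 which $\varepsilon,\eta$ are adjacent iff there is $1\le i<n$ with $\varepsilon(i)=\eta(i+1)$, $\varepsilon(i+1)=\eta(i)$, $\varepsilon(k)=\eta(k)$ for $k\ne i,i+1$, and $\Delta w(\varepsilon(i),\varepsilon(i+1)\,|\,\{\varepsilon(j):j<i\})=0$. *)

theory Defs
  imports "HOL-Analysis.Analysis" "HOL-Library.Set_Algebras"
begin

text \<open>
  The finite non-empty set \<open>N\<close> is the universe of a type \<open>'n\<close> of class \<open>finite\<close>. A set function on
  \<open>N\<close> is a vector indexed by the finite type \<open>'n set\<close>, so that the space of games is Euclidean
  and the library's faces and open segments apply.
\<close>

type_synonym 'n setfun = "real ^ 'n set"

definition supermodular_games :: "('n::finite) setfun set" where
  "supermodular_games =
     {w. w $ {} = 0 \<and> (\<forall>D E. w $ (D \<union> E) + w $ (D \<inter> E) \<ge> w $ D + w $ E)}"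

definition smallest_face :: "'a::real_vector set \<Rightarrow> 'a \<Rightarrow> 'a set" where
  "smallest_face K w = \<Inter>{F. F face_of K \<and> w \<in> F}"

definition core :: "('n::finite) setfun \<Rightarrow> (real ^ 'n) set" where
  "core w = {z. (\<Sum>l\<in>UNIV. z $ l) = w $ UNIV \<and> (\<forall>S. (\<Sum>l\<in>S. z $ l) \<ge> w $ S)}"

definition vertices :: "'a::real_vector set \<Rightarrow> 'a set" where
  "vertices P = {y. y extreme_point_of P}"

definition normal_cone :: "'a::real_inner set \<Rightarrow> 'a \<Rightarrow> 'a set" where
  "normal_cone P y = {x. \<forall>z\<in>P. x \<bullet> (y - z) \<ge> 0}"

definition normal_fan :: "'a::real_inner set \<Rightarrow> 'a set set" where
  "normal_fan P = normal_cone P ` P"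

text \<open>
  Enumerations are bijections from \<open>{1..n}\<close>, made extensional so that each of them
  is represented by exactly one function on \<open>nat\<close>.
\<close>

definition enumerations :: "(nat \<Rightarrow> 'n::finite) set" where
  "enumerations = {\<epsilon> \<in> extensional {1..CARD('n)}. bij_betw \<epsilon> {1..CARD('n)} UNIV}"

definition enum_pos :: "(nat \<Rightarrow> 'n::finite) \<Rightarrow> 'n \<Rightarrow> nat" where
  "enum_pos \<epsilon> = inv_into {1..CARD('n)} \<epsilon>"

definition enum_le :: "(nat \<Rightarrow> 'n::finite) \<Rightarrow> 'n \<Rightarrow> 'n \<Rightarrow> bool" where
  "enum_le \<epsilon> u v \<longleftrightarrow> enum_pos \<epsilon> u \<le> enum_pos \<epsilon> v"

definition marginal_vector :: "('n::finite) setfun \<Rightarrow> (nat \<Rightarrow> 'n) \<Rightarrow> real ^ 'n" where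
  "marginal_vector w \<epsilon> =
     (\<chi> u. w $ (\<epsilon> ` {1..enum_pos \<epsilon> u}) - w $ (\<epsilon> ` {1..<enum_pos \<epsilon> u}))"

definition marginal_fibre :: "('n::finite) setfun \<Rightarrow> real ^ 'n \<Rightarrow> (nat \<Rightarrow> 'n) set" where
  "marginal_fibre w y = {\<epsilon> \<in> enumerations. marginal_vector w \<epsilon> = y}"

definition tightness_class :: "('n::finite) setfun \<Rightarrow> real ^ 'n \<Rightarrow> 'n set set" where
  "tightness_class w y = {S. (\<Sum>l\<in>S. y $ l) = w $ S}"

definition common_order :: "(nat \<Rightarrow> 'n::finite) set \<Rightarrow> ('n \<times> 'n) set" where
  "common_order S = {(u, v). \<forall>\<epsilon>\<in>S. enum_le \<epsilon> u v}"

definition elementary_triplets :: "('n \<times> 'n \<times> 'n set) set" where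
  "elementary_triplets = {(a, b, C). a \<noteq> b \<and> C \<subseteq> UNIV - {a, b}}"

definition Delta :: "('n::finite) setfun \<Rightarrow> 'n \<Rightarrow> 'n \<Rightarrow> 'n set \<Rightarrow> real" where
  "Delta w a b C = w $ (C \<union> {a, b}) + w $ C - w $ (C \<union> {a}) - w $ (C \<union> {b})"

definition enumeration_partition :: "('n::finite) setfun \<Rightarrow> (nat \<Rightarrow> 'n) set set" where
  "enumeration_partition w = marginal_fibre w ` vertices (core w)"

definition fan_of_posets :: "('n::finite) setfun \<Rightarrow> ('n \<times> 'n) set set" where
  "fan_of_posets w = (\<lambda>y. common_order (marginal_fibre w y)) ` vertices (core w)"

definition tightness_structure :: "('n::finite) setfun \<Rightarrow> 'n set set set" where
  "tightness_structure w = tightness_class w ` vertices (core w)"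

definition independence_structure :: "('n::finite) setfun \<Rightarrow> ('n \<times> 'n \<times> 'n set) set" where
  "independence_structure w = {(a, b, C) \<in> elementary_triplets. Delta w a b C = 0}"

text \<open>
  An undirected graph is a pair of its node set and its set of edges, an edge being an
  unordered pair of nodes.
\<close>

type_synonym 'v ugraph = "'v set \<times> 'v set set"

definition is_subgraph :: "'v ugraph \<Rightarrow> 'v ugraph \<Rightarrow> bool" where
  "is_subgraph G H \<longleftrightarrow> fst G \<subseteq> fst H \<and> snd G \<subseteq> snd H"

definition permutohedral_adjacent ::
  "('n::finite) setfun \<Rightarrow> (nat \<Rightarrow> 'n) \<Rightarrow> (nat \<Rightarrow> 'n) \<Rightarrow> bool" where
  "permutohedral_adjacent w \<epsilon> \<eta> \<longleftrightarrow>
     (\<exists>i. 1 \<le> i \<and> i < CARD('n) \<and> \<epsilon> i = \<eta> (i + 1) \<and> \<epsilon> (i + 1) = \<eta> i \<and>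
        (\<forall>k\<in>{1..CARD('n)} - {i, i + 1}. \<epsilon> k = \<eta> k) \<and>
        Delta w (\<epsilon> i) (\<epsilon> (i + 1)) (\<epsilon> ` {1..<i}) = 0)"

definition permutohedral_subgraph :: "('n::finite) setfun \<Rightarrow> (nat \<Rightarrow> 'n) ugraph" where
  "permutohedral_subgraph w =
     (enumerations,
      {{\<epsilon>, \<eta>} |\<epsilon> \<eta>. \<epsilon> \<in> enumerations \<and> \<eta> \<in> enumerations \<and> permutohedral_adjacent w \<epsilon> \<eta>})"

end

theory Submission
  imports Defs
begin

text \<open>
  Supermodularity is equivalent to \<open>Delta w a b C \<ge> 0\<close> for all elementary triplets, so
  \<open>\<I>(r) \<subseteq> \<I>(m)\<close> lets one move from \<open>m\<close> through \<open>r\<close> a little further within the cone,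
  while conversely each equation \<open>Delta w a b C = 0\<close> cuts out a face. The greedy algorithm shows
  that the vertices of the core are exactly the marginal vectors, which are linear in the
  game; hence cores are additive, and the normal fan of a Minkowski sum refines those of its
  summands. The combinatorial conditions all say that \<open>\<phi>\<^sup>r(\<epsilon>) = \<phi>\<^sup>r(\<eta>)\<close> implies
  \<open>\<phi>\<^sup>m(\<epsilon>) = \<phi>\<^sup>m(\<eta>)\<close>: a marginal vector is the unique point at which all prefixes of its
  enumeration are tight, the tight sets of a point form a lattice, and for enumerations that
  differ by an adjacent transposition, equality of the marginal vectors amounts to one
  equation \<open>Delta w a b C = 0\<close>.
\<close>

text \<open>Keeps the lower bound of \<open>{1..i}\<close> in the form \<open>1\<close>, so that
  prefixes match syntactically.\<close>

declare One_nat_def [simp del]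

section \<open>Enumerations and their prefixes\<close>

lemma enumeration_bij:
  "\<epsilon> \<in> enumerations \<Longrightarrow> bij_betw \<epsilon> {1..CARD('n)} (UNIV :: 'n::finite set)"
  by (simp add: enumerations_def)

lemma enumeration_inj: "\<epsilon> \<in> enumerations \<Longrightarrow> inj_on \<epsilon> {1..CARD('n)}"
  for \<epsilon> :: "nat \<Rightarrow> 'n::finite"
  using enumeration_bij bij_betw_imp_inj_on by blast

lemma enumeration_image: "\<epsilon> \<in> enumerations \<Longrightarrow> \<epsilon> ` {1..CARD('n)} = UNIV"
  for \<epsilon> :: "nat \<Rightarrow> 'n::finite"
  using enumeration_bij bij_betw_imp_surj_on by blast

lemma enum_pos_apply: "enum_pos \<epsilon> (\<epsilon> i) = i"
  if "\<epsilon> \<in> enumerations" "i \<in> {1..CARD('n)}" for \<epsilon> :: "nat \<Rightarrow> 'n::finite"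
  using that enumeration_inj inv_into_f_f unfolding enum_pos_def by metis

lemma enum_pos_mem: "enum_pos \<epsilon> u \<in> {1..CARD('n)}"
  if "\<epsilon> \<in> enumerations" for \<epsilon> :: "nat \<Rightarrow> 'n::finite"
  unfolding enum_pos_def by (rule inv_into_into) (simp add: enumeration_image[OF that])

lemma apply_enum_pos: "\<epsilon> (enum_pos \<epsilon> u) = u"
  if "\<epsilon> \<in> enumerations" for \<epsilon> :: "nat \<Rightarrow> 'n::finite"
  unfolding enum_pos_def by (rule f_inv_into_f) (simp add: enumeration_image[OF that])

lemma enum_pos_inj: "\<epsilon> \<in> enumerations \<Longrightarrow> enum_pos \<epsilon> u = enum_pos \<epsilon> v \<longleftrightarrow> u = v"
  by (metis apply_enum_pos)

lemma mem_prefix_iff: "v \<in> \<epsilon> ` {1..i} \<longleftrightarrow> enum_pos \<epsilon> v \<le> i"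
  if "\<epsilon> \<in> enumerations" "i \<le> CARD('n)" for \<epsilon> :: "nat \<Rightarrow> 'n::finite"
proof
  assume "v \<in> \<epsilon> ` {1..i}"
  then obtain j where "j \<in> {1..i}" "v = \<epsilon> j" by blast
  then show "enum_pos \<epsilon> v \<le> i"
    using enum_pos_apply[OF that(1), of j] that(2) by auto
next
  assume "enum_pos \<epsilon> v \<le> i"
  then have "enum_pos \<epsilon> v \<in> {1..i}" using enum_pos_mem[OF that(1), of v] by auto
  then show "v \<in> \<epsilon> ` {1..i}" using apply_enum_pos[OF that(1), of v] by (metis imageI)
qed

lemma prefix_Suc: "\<epsilon> ` {1..Suc i} = insert (\<epsilon> (Suc i)) (\<epsilon> ` {1..i})"
  by (simp add: atLeastAtMostSuc_conv)

lemma prefix_Suc_notin: "\<epsilon> (Suc i) \<notin> \<epsilon> ` {1..i}"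
  if "\<epsilon> \<in> enumerations" "i < CARD('n)" for \<epsilon> :: "nat \<Rightarrow> 'n::finite"
  using that enum_pos_apply[of \<epsilon> "Suc i"] by (subst mem_prefix_iff) auto

lemma sum_prefix_Suc: "sum f (\<epsilon> ` {1..Suc i}) = sum f (\<epsilon> ` {1..i}) + f (\<epsilon> (Suc i))"
  if "\<epsilon> \<in> enumerations" "i < CARD('n)"
  for \<epsilon> :: "nat \<Rightarrow> 'n::finite" and f :: "'n \<Rightarrow> real"
  unfolding prefix_Suc using prefix_Suc_notin[OF that] by (subst sum.insert) auto

text \<open>Enumerations adapted to a situation come from sorting by a suitable key: the greedy
  order, a chain through a tight set, a triplet placed at consecutive positions.\<close>

lemma sorted_enumeration_exists:
  fixes f :: "'n::finite \<Rightarrow> 'a::linorder"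
  obtains \<epsilon> where "\<epsilon> \<in> enumerations"
    and "\<And>i j. 1 \<le> i \<Longrightarrow> i \<le> j \<Longrightarrow> j \<le> CARD('n) \<Longrightarrow> f (\<epsilon> i) \<le> f (\<epsilon> j)"
proof -
  obtain xs0 :: "'n list" where xs0: "set xs0 = UNIV" "distinct xs0"
    using finite_distinct_list[of "UNIV :: 'n set"] by auto
  define xs where "xs = sort_key f xs0"
  have xs: "set xs = UNIV" "distinct xs" "sorted (map f xs)"
    using xs0 by (auto simp: xs_def)
  have len: "length xs = CARD('n)" using xs(1,2) distinct_card by fastforce
  \<comment> \<open>List positions start at 0, enumerations at 1; \<open>restrict\<close> makes the
    function extensional.\<close>
  define \<epsilon> where "\<epsilon> = restrict (\<lambda>i. xs ! (i - 1)) {1..CARD('n)}"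
  have "bij_betw (\<lambda>i. i - 1) {1..CARD('n)} {..<CARD('n)}"
    by (rule bij_betw_byWitness[where f' = Suc]) auto
  moreover have "bij_betw ((!) xs) {..<CARD('n)} UNIV"
    using bij_betw_nth[OF xs(2), of "{..<CARD('n)}" UNIV] xs(1) len by simp
  ultimately have "bij_betw ((!) xs \<circ> (\<lambda>i. i - 1)) {1..CARD('n)} UNIV"
    by (rule bij_betw_trans)
  then have "bij_betw \<epsilon> {1..CARD('n)} UNIV"
    by (rule bij_betw_cong[THEN iffD1, rotated]) (simp add: \<epsilon>_def)
  then have "\<epsilon> \<in> enumerations"
    by (simp add: enumerations_def \<epsilon>_def)
  moreover have "f (\<epsilon> i) \<le> f (\<epsilon> j)" if "1 \<le> i" "i \<le> j" "j \<le> CARD('n)" for i j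
    using sorted_nth_mono[OF xs(3), of "i - 1" "j - 1"] that len by (auto simp: \<epsilon>_def)
  ultimately show ?thesis using that by blast
qed

text \<open>If an element outside \<open>S\<close> stood at a position
  \<open>i \<le> card S\<close>, all of \<open>S\<close> would have to fit into the first
  \<open>i - 1\<close> positions.\<close>

lemma sorted_prefix_eq:
  fixes f :: "'n::finite \<Rightarrow> 'a::linorder"
  assumes e: "\<epsilon> \<in> enumerations"
    and mono: "\<And>i j. 1 \<le> i \<Longrightarrow> i \<le> j \<Longrightarrow> j \<le> CARD('n) \<Longrightarrow> f (\<epsilon> i) \<le> f (\<epsilon> j)"
    and sep: "\<And>u v. u \<in> S \<Longrightarrow> v \<notin> S \<Longrightarrow> f u < f v"
  shows "\<epsilon> ` {1..card S} = S"
proof (rule card_subset_eq)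
  have cS: "card S \<le> CARD('n)" by (simp add: card_mono)
  show "\<epsilon> ` {1..card S} \<subseteq> S"
  proof (rule ccontr)
    assume "\<not> ?thesis"
    then obtain i where "i \<in> {1..card S}" "\<epsilon> i \<notin> S" by blast
    then have i: "1 \<le> i" "i \<le> card S" "\<epsilon> i \<notin> S" by auto
    have "S \<subseteq> \<epsilon> ` {1..i - 1}"
    proof
      fix u assume "u \<in> S"
      then have "f u < f (\<epsilon> i)" using sep i by blast
      then have "\<not> i \<le> enum_pos \<epsilon> u"
        using mono[of i "enum_pos \<epsilon> u"] i enum_pos_mem[OF e, of u]
        by (auto simp: apply_enum_pos[OF e])
      then show "u \<in> \<epsilon> ` {1..i - 1}"
        using i cS by (subst mem_prefix_iff[OF e]) auto
    qed
    then have "card S \<le> card (\<epsilon> ` {1..i - 1})" by (simp add: card_mono)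
    also have "\<dots> \<le> i - 1" using card_image_le[of "{1..i - 1}" \<epsilon>] by simp
    finally show False using i by simp
  qed
  show "card (\<epsilon> ` {1..card S}) = card S"
    using card_image[OF inj_on_subset[OF enumeration_inj[OF e], of "{1..card S}"]] cS by simp
qed simp

text \<open>Injectivity excludes ties, so comparing positions amounts to comparing keys.\<close>

lemma sorted_prefix_inj:
  fixes f :: "'n::finite \<Rightarrow> 'a::linorder"
  assumes e: "\<epsilon> \<in> enumerations"
    and mono: "\<And>i j. 1 \<le> i \<Longrightarrow> i \<le> j \<Longrightarrow> j \<le> CARD('n) \<Longrightarrow> f (\<epsilon> i) \<le> f (\<epsilon> j)"
    and f: "inj f" and i: "1 \<le> i" "i \<le> CARD('n)"
  shows "\<epsilon> ` {1..i} = {v. f v \<le> f (\<epsilon> i)}"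
proof (intro set_eqI)
  fix v
  have v: "\<epsilon> (enum_pos \<epsilon> v) = v" "1 \<le> enum_pos \<epsilon> v" "enum_pos \<epsilon> v \<le> CARD('n)"
    using apply_enum_pos[OF e] enum_pos_mem[OF e, of v] by auto
  have "enum_pos \<epsilon> v \<le> i \<longleftrightarrow> f v \<le> f (\<epsilon> i)"
  proof
    assume "enum_pos \<epsilon> v \<le> i"
    then show "f v \<le> f (\<epsilon> i)" using mono[of "enum_pos \<epsilon> v" i] v i by simp
  next
    assume le: "f v \<le> f (\<epsilon> i)"
    show "enum_pos \<epsilon> v \<le> i"
    proof (rule ccontr)
      assume gt: "\<not> ?thesis"
      then have "f (\<epsilon> i) \<le> f v" using mono[of i "enum_pos \<epsilon> v"] v i by simp
      then have "v = \<epsilon> i" using le f by (simp add: inj_def)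
      then show False using gt enum_pos_apply[OF e, of i] i by simp
    qed
  qed
  then show "v \<in> \<epsilon> ` {1..i} \<longleftrightarrow> v \<in> {v. f v \<le> f (\<epsilon> i)}"
    by (simp add: mem_prefix_iff[OF e i(2)])
qed

section \<open>Adjacent transpositions of enumerations\<close>

text \<open>The part of \<open>permutohedral_adjacent\<close> that does not depend on the
  game.\<close>

definition swapped_at :: "nat \<Rightarrow> (nat \<Rightarrow> 'n::finite) \<Rightarrow> (nat \<Rightarrow> 'n) \<Rightarrow> bool" where
  "swapped_at i \<epsilon> \<eta> \<longleftrightarrow> 1 \<le> i \<and> i < CARD('n) \<and> \<epsilon> i = \<eta> (i + 1) \<and> \<epsilon> (i + 1) = \<eta> i \<and>
     (\<forall>k\<in>{1..CARD('n)} - {i, i + 1}. \<epsilon> k = \<eta> k)"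

text \<open>Prefixes shorter than \<open>i\<close> miss both swapped positions and those longer than
  \<open>i\<close> contain both, so only the prefix of length \<open>i\<close> changes.\<close>

lemma swapped_prefix:
  fixes \<epsilon> \<eta> :: "nat \<Rightarrow> 'n::finite"
  assumes "swapped_at i \<epsilon> \<eta>"
  shows "\<eta> ` {1..i} = insert (\<epsilon> (i + 1)) (\<epsilon> ` {1..<i})"
    and "k \<le> CARD('n) \<Longrightarrow> k \<noteq> i \<Longrightarrow> \<eta> ` {1..k} = \<epsilon> ` {1..k}"
proof -
  note s = assms[unfolded swapped_at_def]
  have low: "\<eta> ` {1..<i} = \<epsilon> ` {1..<i}" using s by (intro image_cong) auto
  have "{1..i} = insert i {1..<i}" using s by auto
  then have "\<eta> ` {1..i} = insert (\<eta> i) (\<eta> ` {1..<i})" by simp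
  then show "\<eta> ` {1..i} = insert (\<epsilon> (i + 1)) (\<epsilon> ` {1..<i})"
    using low s by metis
  assume k: "k \<le> CARD('n)" "k \<noteq> i"
  show "\<eta> ` {1..k} = \<epsilon> ` {1..k}"
  proof (cases "k < i")
    case True
    then show ?thesis using s k by (intro image_cong) auto
  next
    case False
    then have K: "{1..k} = {i, i + 1} \<union> ({1..k} - {i, i + 1})" using k s by auto
    have "\<eta> ` ({1..k} - {i, i + 1}) = \<epsilon> ` ({1..k} - {i, i + 1})"
      using s k by (intro image_cong) auto
    moreover have "\<eta> ` {i, i + 1} = \<epsilon> ` {i, i + 1}" using s by auto
    ultimately show ?thesis by (subst (1 2) K) (simp only: image_Un)
  qed
qed

lemma swapped_exists:
  fixes \<epsilon> :: "nat \<Rightarrow> 'n::finite"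
  assumes e: "\<epsilon> \<in> enumerations" and i: "1 \<le> i" "i < CARD('n)"
  obtains \<eta> where "\<eta> \<in> enumerations" "swapped_at i \<epsilon> \<eta>"
proof -
  define \<tau> where "\<tau> = id(i := i + 1, i + 1 := i)"
  have "bij_betw \<tau> {1..CARD('n)} {1..CARD('n)}"
    by (rule bij_betw_byWitness[where f' = \<tau>]) (use i in \<open>auto simp: \<tau>_def\<close>)
  then have "bij_betw (\<epsilon> \<circ> \<tau>) {1..CARD('n)} UNIV"
    using enumeration_bij[OF e] by (rule bij_betw_trans)
  \<comment> \<open>\<open>\<tau>\<close> fixes every index outside \<open>{1..CARD('n)}\<close>,
    where \<open>\<epsilon>\<close> is \<open>undefined\<close>.\<close>
  moreover have "\<epsilon> \<circ> \<tau> \<in> extensional {1..CARD('n)}"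
    using e i by (auto simp: extensional_def enumerations_def \<tau>_def)
  ultimately have "\<epsilon> \<circ> \<tau> \<in> enumerations" by (simp add: enumerations_def)
  moreover have "swapped_at i \<epsilon> (\<epsilon> \<circ> \<tau>)"
    using i by (auto simp: swapped_at_def \<tau>_def)
  ultimately show ?thesis using that by blast
qed

section \<open>Marginal vectors\<close>

lemma marginal_vector_Suc:
  "marginal_vector w \<epsilon> $ \<epsilon> (Suc i) = w $ (\<epsilon> ` {1..Suc i}) - w $ (\<epsilon> ` {1..i})"
  if "\<epsilon> \<in> enumerations" "i < CARD('n)" for \<epsilon> :: "nat \<Rightarrow> 'n::finite"
  using enum_pos_apply[OF that(1), of "Suc i"] that(2)
  by (simp add: marginal_vector_def atLeastLessThanSuc_atLeastAtMost)

text \<open>The increments telescope, starting from \<open>w $ {} = 0\<close>.\<close>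

lemma sum_marginal_prefix:
  "(\<Sum>l\<in>\<epsilon> ` {1..i}. marginal_vector w \<epsilon> $ l) = w $ (\<epsilon> ` {1..i})"
  if e: "\<epsilon> \<in> enumerations" and w: "w $ {} = 0" and "i \<le> CARD('n)"
  for \<epsilon> :: "nat \<Rightarrow> 'n::finite"
  using that(3)
proof (induction i)
  case 0
  then show ?case by (simp add: w)
next
  case (Suc i)
  then have i: "i < CARD('n)" and "i \<le> CARD('n)" by simp_all
  then show ?case
    unfolding sum_prefix_Suc[OF e i] marginal_vector_Suc[OF e i] using Suc.IH by simp
qed

text \<open>Each coordinate of \<open>y\<close> is the difference of its sums over two consecutive
  prefixes, so tightness of all prefixes determines \<open>y\<close>. This translates equality of
  marginal vectors into tightness.\<close>

lemma marginal_vector_eq_iff: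
  fixes \<epsilon> :: "nat \<Rightarrow> 'n::finite"
  assumes e: "\<epsilon> \<in> enumerations" and w: "w $ {} = 0"
  shows "marginal_vector w \<epsilon> = y \<longleftrightarrow> (\<forall>i\<le>CARD('n). \<epsilon> ` {1..i} \<in> tightness_class w y)"
proof
  assume "marginal_vector w \<epsilon> = y"
  then show "\<forall>i\<le>CARD('n). \<epsilon> ` {1..i} \<in> tightness_class w y"
    using sum_marginal_prefix[OF e w] by (auto simp: tightness_class_def)
next
  assume t: "\<forall>i\<le>CARD('n). \<epsilon> ` {1..i} \<in> tightness_class w y"
  show "marginal_vector w \<epsilon> = y"
  proof (rule vec_eq_iff[THEN iffD2, rule_format])
    fix u
    obtain i where "enum_pos \<epsilon> u = Suc i"
      using enum_pos_mem[OF e, of u] by (cases "enum_pos \<epsilon> u") auto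
    then have i: "i < CARD('n)" "u = \<epsilon> (Suc i)"
      using enum_pos_mem[OF e, of u] apply_enum_pos[OF e, of u] by auto
    have "\<epsilon> ` {1..i} \<in> tightness_class w y" "\<epsilon> ` {1..Suc i} \<in> tightness_class w y"
      using t i(1) by (metis Suc_leI less_imp_le_nat)+
    then have "w $ (\<epsilon> ` {1..Suc i}) = w $ (\<epsilon> ` {1..i}) + y $ u"
      using sum_prefix_Suc[OF e i(1), of "($) y"] i(2) by (simp add: tightness_class_def)
    then show "marginal_vector w \<epsilon> $ u = y $ u"
      using marginal_vector_Suc[OF e i(1), of w] i by simp
  qed
qed

lemma marginal_vector_linear:
  "marginal_vector (a *\<^sub>R v + b *\<^sub>R w) \<epsilon> = a *\<^sub>R marginal_vector v \<epsilon> + b *\<^sub>R marginal_vector w \<epsilon>"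
  by (simp add: marginal_vector_def vec_eq_iff algebra_simps)

text \<open>Only one prefix of \<open>\<eta>\<close> has to be tested for tightness at the marginal
  vector of \<open>\<epsilon>\<close>. With \<open>a = \<epsilon> i\<close>,
  \<open>b = \<epsilon> (i + 1)\<close> and \<open>P\<close> the set before them, the test reads
  \<open>w(P+a+b) - w(P+a) + w(P) = w(P+b)\<close>.\<close>

lemma marginal_vector_swapped_iff:
  fixes \<epsilon> \<eta> :: "nat \<Rightarrow> 'n::finite"
  assumes e: "\<epsilon> \<in> enumerations" and h: "\<eta> \<in> enumerations" and w: "w $ {} = 0"
    and s: "swapped_at i \<epsilon> \<eta>"
  shows "marginal_vector w \<epsilon> = marginal_vector w \<eta> \<longleftrightarrow>
    Delta w (\<epsilon> i) (\<epsilon> (i + 1)) (\<epsilon> ` {1..<i}) = 0"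
proof -
  obtain j where j: "i = Suc j" "Suc j < CARD('n)"
    using s by (cases i) (auto simp: swapped_at_def)
  define y where "y = marginal_vector w \<epsilon>"
  define P where "P = \<epsilon> ` {1..j}"
  have P1: "\<epsilon> ` {1..Suc j} = insert (\<epsilon> (Suc j)) P" unfolding P_def by (rule prefix_Suc)
  have P2: "\<epsilon> ` {1..Suc (Suc j)} = insert (\<epsilon> (Suc (Suc j))) (insert (\<epsilon> (Suc j)) P)"
    unfolding P1[symmetric] by (rule prefix_Suc)
  have less: "{1..<i} = {1..j}" using j by auto
  have y: "\<forall>k\<le>CARD('n). \<epsilon> ` {1..k} \<in> tightness_class w y"
    using marginal_vector_eq_iff[OF e w, of y] y_def by simp
  have "\<eta> ` {1..k} \<in> tightness_class w y" if "k \<le> CARD('n)" "k \<noteq> i" for k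
    using y that swapped_prefix(2)[OF s that] by simp
  then have "marginal_vector w \<eta> = y \<longleftrightarrow> \<eta> ` {1..i} \<in> tightness_class w y"
    unfolding marginal_vector_eq_iff[OF h w] using j by (metis less_imp_le)
  also have "\<dots> \<longleftrightarrow> (\<Sum>l\<in>insert (\<epsilon> (i + 1)) P. y $ l) = w $ insert (\<epsilon> (i + 1)) P"
    using swapped_prefix(1)[OF s] by (simp add: tightness_class_def less P_def)
  also have "(\<Sum>l\<in>insert (\<epsilon> (i + 1)) P. y $ l) = y $ \<epsilon> (i + 1) + (\<Sum>l\<in>P. y $ l)"
  proof (rule sum.insert)
    show "\<epsilon> (i + 1) \<notin> P" using prefix_Suc_notin[OF e j(2)] P1 j(1) by (simp add: One_nat_def)
  qed simp
  also have "y $ \<epsilon> (i + 1) = w $ (\<epsilon> ` {1..Suc (Suc j)}) - w $ (\<epsilon> ` {1..Suc j})"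
    using marginal_vector_Suc[OF e j(2), of w] j by (simp add: y_def One_nat_def)
  also have "(\<Sum>l\<in>P. y $ l) = w $ P"
    using y j by (simp add: tightness_class_def P_def)
  finally show ?thesis
    unfolding P1 P2 y_def[symmetric] Delta_def less P_def[symmetric]
    by (auto simp: j(1) insert_commute One_nat_def)
qed

section \<open>The core of a supermodular game\<close>

lemma supermodularD:
  "w \<in> supermodular_games \<Longrightarrow> w $ D + w $ E \<le> w $ (D \<union> E) + w $ (D \<inter> E)"
  by (simp add: supermodular_games_def)

lemma supermodular_empty: "w \<in> supermodular_games \<Longrightarrow> w $ {} = 0"
  by (simp add: supermodular_games_def)

lemma coreD: "z \<in> core w \<Longrightarrow> w $ S \<le> (\<Sum>l\<in>S. z $ l)"
  by (simp add: core_def)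

text \<open>Supermodularity makes the contribution of an element grow with the set it joins. The
  coordinate of an element is its contribution to the whole prefix before it, hence at least its
  contribution to the part of that prefix inside \<open>S\<close>.\<close>

lemma marginal_vector_in_core:
  fixes w :: "('n::finite) setfun"
  assumes w: "w \<in> supermodular_games" and e: "\<epsilon> \<in> enumerations"
  shows "marginal_vector w \<epsilon> \<in> core w"
proof -
  have "w $ (S \<inter> \<epsilon> ` {1..i}) \<le> (\<Sum>l\<in>S \<inter> \<epsilon> ` {1..i}. marginal_vector w \<epsilon> $ l)"
    if "i \<le> CARD('n)" for S i
    using that
  proof (induction i)
    case 0
    then show ?case by (simp add: supermodular_empty[OF w])
  next
    case (Suc i)
    then have i: "i < CARD('n)" by simp
    let ?P = "\<epsilon> ` {1..i}" and ?u = "\<epsilon> (Suc i)"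
    note nin = prefix_Suc_notin[OF e i]
    show ?case
    proof (cases "?u \<in> S")
      case True
      then have S: "S \<inter> \<epsilon> ` {1..Suc i} = insert ?u (S \<inter> ?P)" by (auto simp: prefix_Suc)
      \<comment> \<open>As \<open>?u\<close> is not in \<open>?P\<close>, the two sets have union
        \<open>insert ?u ?P\<close> and intersection \<open>S \<inter> ?P\<close>.\<close>
      have "w $ insert ?u (S \<inter> ?P) + w $ ?P \<le> w $ insert ?u ?P + w $ (S \<inter> ?P)"
        using supermodularD[OF w, of "insert ?u (S \<inter> ?P)" ?P] nin
        by (simp add: Un_commute Un_absorb1 insert_absorb Int_commute Int_left_commute)
      moreover have "(\<Sum>l\<in>insert ?u (S \<inter> ?P). marginal_vector w \<epsilon> $ l) =
          w $ insert ?u ?P - w $ ?P + (\<Sum>l\<in>S \<inter> ?P. marginal_vector w \<epsilon> $ l)"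
        using nin marginal_vector_Suc[OF e i, of w] by (simp add: prefix_Suc)
      ultimately show ?thesis unfolding S using Suc.IH i by simp
    next
      case False
      then have "S \<inter> \<epsilon> ` {1..Suc i} = S \<inter> ?P" by (auto simp: prefix_Suc)
      then show ?thesis using Suc.IH i by simp
    qed
  qed
  from this[of "CARD('n)"] show ?thesis
    using sum_marginal_prefix[OF e supermodular_empty[OF w], of "CARD('n)"]
    by (simp add: core_def enumeration_image[OF e])
qed

lemma convex_core: "convex (core w)"
proof -
  have "core w = {z. (\<Sum>l\<in>UNIV. z $ l) = w $ UNIV} \<inter> (\<Inter>S. {z. w $ S \<le> (\<Sum>l\<in>S. z $ l)})"
    by (auto simp: core_def)
  moreover have "convex {z :: real ^ 'a. (\<Sum>l\<in>UNIV. z $ l) = w $ UNIV}"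
    by (intro convexI)
      (simp add: sum.distrib sum_distrib_left[symmetric] distrib_right[symmetric])
  moreover have "convex {z :: real ^ 'a. w $ S \<le> (\<Sum>l\<in>S. z $ l)}" for S
  proof (rule convexI)
    fix x y :: "real ^ 'a" and s t :: real
    assume xy: "x \<in> {z. w $ S \<le> (\<Sum>l\<in>S. z $ l)}" "y \<in> {z. w $ S \<le> (\<Sum>l\<in>S. z $ l)}"
      and st: "0 \<le> s" "0 \<le> t" "s + t = 1"
    have "w $ S = s * w $ S + t * w $ S" using st(3) by (metis distrib_right mult_1)
    also have "\<dots> \<le> s * (\<Sum>l\<in>S. x $ l) + t * (\<Sum>l\<in>S. y $ l)"
      using xy st by (intro add_mono mult_left_mono) auto
    finally show "s *\<^sub>R x + t *\<^sub>R y \<in> {z. w $ S \<le> (\<Sum>l\<in>S. z $ l)}"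
      by (simp add: sum.distrib sum_distrib_left)
  qed
  ultimately show ?thesis by (auto intro!: convex_Int convex_INT)
qed

text \<open>The greedy algorithm: summation by parts along an enumeration that sorts \<open>a\<close> downwards.\<close>

lemma marginal_vector_minimises:
  fixes a :: "real ^ 'n::finite"
  assumes w: "w \<in> supermodular_games" and z: "z \<in> core w" and e: "\<epsilon> \<in> enumerations"
    and mono: "\<And>i j. 1 \<le> i \<Longrightarrow> i \<le> j \<Longrightarrow> j \<le> CARD('n) \<Longrightarrow> a $ \<epsilon> j \<le> a $ \<epsilon> i"
  shows "a \<bullet> marginal_vector w \<epsilon> \<le> a \<bullet> z"
proof -
  define d where "d = z - marginal_vector w \<epsilon>"
  have d_nonneg: "0 \<le> (\<Sum>l\<in>\<epsilon> ` {1..i}. d $ l)" if "i \<le> CARD('n)" for i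
    using coreD[OF z] sum_marginal_prefix[OF e supermodular_empty[OF w] that]
    by (simp add: d_def sum_subtractf)
  \<comment> \<open>The prefix sums of \<open>d\<close> are nonnegative, so the coefficient in front
    of them may be lowered to the next value of \<open>a\<close> at each step.\<close>
  have partial: "a $ \<epsilon> (Suc i) * (\<Sum>l\<in>\<epsilon> ` {1..Suc i}. d $ l) \<le> (\<Sum>l\<in>\<epsilon> ` {1..Suc i}. a $ l * d $ l)"
    if "i < CARD('n)" for i
    using that
  proof (induction i)
    case 0
    then show ?case by (simp add: One_nat_def)
  next
    case (Suc i)
    have "a $ \<epsilon> (Suc (Suc i)) * (\<Sum>l\<in>\<epsilon> ` {1..Suc i}. d $ l)
        \<le> a $ \<epsilon> (Suc i) * (\<Sum>l\<in>\<epsilon> ` {1..Suc i}. d $ l)"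
      using Suc.prems by (intro mult_right_mono mono d_nonneg) auto
    also have "\<dots> \<le> (\<Sum>l\<in>\<epsilon> ` {1..Suc i}. a $ l * d $ l)" using Suc by simp
    finally show ?case
      unfolding sum_prefix_Suc[OF e Suc.prems] by (simp add: distrib_left)
  qed
  \<comment> \<open>At full length the left side of \<open>partial\<close> vanishes, whatever the
    sign of the last value of \<open>a\<close>.\<close>
  have "(\<Sum>l\<in>UNIV. d $ l) = 0"
    using z marginal_vector_in_core[OF w e] by (simp add: core_def d_def sum_subtractf)
  then have "0 \<le> (\<Sum>l\<in>UNIV. a $ l * d $ l)"
    using partial[of "CARD('n) - 1"] enumeration_image[OF e] by simp
  then show ?thesis by (simp add: d_def inner_vec_def algebra_simps sum_subtractf)
qed

text \<open>A hyperplane separating a core point from all marginal vectors would contradict the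
  optimality of the greedy one.\<close>

lemma core_subset_hull:
  fixes w :: "('n::finite) setfun"
  assumes w: "w \<in> supermodular_games"
  shows "core w \<subseteq> convex hull (marginal_vector w ` enumerations)"
proof (rule subsetI, rule ccontr)
  fix z
  assume z: "z \<in> core w" and nin: "z \<notin> convex hull (marginal_vector w ` enumerations)"
  \<comment> \<open>Finiteness rests on extensionality; it makes the hull closed, as the separation
    theorem requires.\<close>
  have "finite (enumerations :: (nat \<Rightarrow> 'n) set)"
    by (rule finite_subset[OF _ finite_PiE[of "{1..CARD('n)}" "\<lambda>_. UNIV"]])
      (auto simp: enumerations_def PiE_def)
  then have "closed (convex hull (marginal_vector w ` enumerations))"
    by (intro compact_imp_closed finite_imp_compact_convex_hull finite_imageI)
  then obtain a b where ab: "a \<bullet> z < b"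
      "\<And>x. x \<in> convex hull (marginal_vector w ` enumerations) \<Longrightarrow> b < a \<bullet> x"
    using separating_hyperplane_closed_point[OF convex_convex_hull _ nin] by blast
  obtain \<epsilon> where e: "\<epsilon> \<in> enumerations"
    "\<And>i j. 1 \<le> i \<Longrightarrow> i \<le> j \<Longrightarrow> j \<le> CARD('n) \<Longrightarrow> - (a $ \<epsilon> i) \<le> - (a $ \<epsilon> j)"
    using sorted_enumeration_exists[of "\<lambda>u. - (a $ u)"] by blast
  then have "a \<bullet> marginal_vector w \<epsilon> \<le> a \<bullet> z"
    by (intro marginal_vector_minimises[OF w z]) auto
  moreover have "b < a \<bullet> marginal_vector w \<epsilon>"
    using e by (intro ab(2) hull_inc) auto
  ultimately show False using ab(1) by simp
qed

text \<open>The core is the hull of the marginal vectors, so its vertices are among them.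
  Conversely, if a marginal vector lies inside a segment of the core, its tight prefixes are tight
  at both endpoints, which must then coincide with it.\<close>

lemma vertices_core:
  fixes w :: "('n::finite) setfun"
  assumes w: "w \<in> supermodular_games"
  shows "vertices (core w) = marginal_vector w ` enumerations"
proof
  let ?H = "convex hull (marginal_vector w ` enumerations)"
  have "core w = ?H"
    using core_subset_hull[OF w] marginal_vector_in_core[OF w] convex_core[of w]
    by (intro equalityI hull_minimal) auto
  then show "vertices (core w) \<subseteq> marginal_vector w ` enumerations"
    by (auto simp: vertices_def dest: extreme_point_of_convex_hull)
next
  show "marginal_vector w ` enumerations \<subseteq> vertices (core w)"
  proof (clarsimp simp: vertices_def extreme_point_of_def marginal_vector_in_core[OF w])
    fix \<epsilon> x y
    assume e: "\<epsilon> \<in> enumerations" and xy: "x \<in> core w" "y \<in> core w"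
      and seg: "marginal_vector w \<epsilon> \<in> open_segment x y"
    obtain t where t: "0 < t" "t < 1" and mt: "marginal_vector w \<epsilon> = (1 - t) *\<^sub>R x + t *\<^sub>R y"
      and ne: "x \<noteq> y"
      using seg by (auto simp: in_segment)
    have "marginal_vector w \<epsilon> = x \<and> marginal_vector w \<epsilon> = y"
      unfolding marginal_vector_eq_iff[OF e supermodular_empty[OF w]]
    proof (intro conjI allI impI)
      fix i assume "i \<le> CARD('n)"
      let ?P = "\<epsilon> ` {1..i}"
      \<comment> \<open>The slacks of the prefix at the two endpoints: both are nonnegative, and a
        positive combination of them is zero.\<close>
      define p q where "p = (\<Sum>l\<in>?P. x $ l) - w $ ?P" and "q = (\<Sum>l\<in>?P. y $ l) - w $ ?P"
      have "p \<ge> 0" "q \<ge> 0" using coreD xy by (auto simp: p_def q_def)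
      have "w $ ?P = (1 - t) * (\<Sum>l\<in>?P. x $ l) + t * (\<Sum>l\<in>?P. y $ l)"
        using sum_marginal_prefix[OF e supermodular_empty[OF w] \<open>i \<le> CARD('n)\<close>]
        by (simp add: mt sum.distrib sum_distrib_left)
      then have "(1 - t) * p + t * q = 0" by (simp add: p_def q_def algebra_simps)
      moreover have "(1 - t) * p \<ge> 0" "t * q \<ge> 0" using t \<open>p \<ge> 0\<close> \<open>q \<ge> 0\<close> by auto
      ultimately have "(1 - t) * p = 0" "t * q = 0" by linarith+
      then have "p = 0" "q = 0" using t by auto
      then show "?P \<in> tightness_class w x" "?P \<in> tightness_class w y"
        by (auto simp: tightness_class_def p_def q_def)
    qed
    then show False using ne by metis
  qed
qed

section \<open>Tight sets of a core point\<close>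

text \<open>The core inequalities for \<open>D \<union> E\<close> and \<open>D \<inter> E\<close>
  sum to the reverse of the supermodular inequality, so both are equalities.\<close>

lemma tight_Un_Int:
  assumes w: "w \<in> supermodular_games" and y: "y \<in> core w"
    and D: "D \<in> tightness_class w y" and E: "E \<in> tightness_class w y"
  shows "D \<union> E \<in> tightness_class w y" "D \<inter> E \<in> tightness_class w y"
proof -
  have "(\<Sum>l\<in>D \<union> E. y $ l) + (\<Sum>l\<in>D \<inter> E. y $ l) = (\<Sum>l\<in>D. y $ l) + (\<Sum>l\<in>E. y $ l)"
    by (rule sum.union_inter) auto
  moreover have "w $ D + w $ E \<le> w $ (D \<union> E) + w $ (D \<inter> E)" by (rule supermodularD[OF w])
  ultimately show "D \<union> E \<in> tightness_class w y" "D \<inter> E \<in> tightness_class w y"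
    using D E coreD[OF y, of "D \<union> E"] coreD[OF y, of "D \<inter> E"]
    by (auto simp: tightness_class_def)
qed

text \<open>
  If all prefixes \<open>P\<close> of an enumeration are tight, then so are the sets \<open>S \<inter> P\<close> and
  \<open>S \<union> P\<close>, which together form a maximal chain through \<open>S\<close>.
\<close>

lemma tight_set_is_prefix:
  fixes w :: "('n::finite) setfun"
  assumes w: "w \<in> supermodular_games" and e: "\<epsilon> \<in> enumerations"
    and y: "marginal_vector w \<epsilon> = y" and S: "S \<in> tightness_class w y"
  obtains \<eta> where "\<eta> \<in> enumerations" "marginal_vector w \<eta> = y" "\<eta> ` {1..card S} = S"
proof -
  note w0 = supermodular_empty[OF w]
  have yc: "y \<in> core w" using marginal_vector_in_core[OF w e] y by simp
  have tight: "\<epsilon> ` {1..i} \<in> tightness_class w y" if "i \<le> CARD('n)" for i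
    using marginal_vector_eq_iff[OF e w0, of y] y that by simp
  have empty: "{} \<in> tightness_class w y" by (simp add: tightness_class_def w0)
  \<comment> \<open>Positions are at most \<open>CARD('n)\<close>, so this key puts \<open>S\<close>
    first and keeps the order of \<open>\<epsilon>\<close> inside \<open>S\<close> and inside its
    complement.\<close>
  define f where "f u = (if u \<in> S then enum_pos \<epsilon> u else CARD('n) + enum_pos \<epsilon> u)" for u
  have pos: "1 \<le> enum_pos \<epsilon> u" "enum_pos \<epsilon> u \<le> CARD('n)" for u
    using enum_pos_mem[OF e, of u] by auto
  have "inj f"
  proof (rule injI)
    fix u v assume "f u = f v"
    then have "enum_pos \<epsilon> u = enum_pos \<epsilon> v"
      using pos[of u] pos[of v] by (simp add: f_def split: if_splits)
    then show "u = v" by (simp add: enum_pos_inj[OF e])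
  qed
  obtain \<eta> where h: "\<eta> \<in> enumerations"
    and mono: "\<And>i j. 1 \<le> i \<Longrightarrow> i \<le> j \<Longrightarrow> j \<le> CARD('n) \<Longrightarrow> f (\<eta> i) \<le> f (\<eta> j)"
    using sorted_enumeration_exists[of f] by blast
  have "\<eta> ` {1..card S} = S"
  proof (rule sorted_prefix_eq[where f = f, OF h mono])
    show "f u < f v" if "u \<in> S" "v \<notin> S" for u v
      using that pos[of u] pos[of v] by (simp add: f_def)
  qed
  moreover have "\<eta> ` {1..i} \<in> tightness_class w y" if i: "i \<le> CARD('n)" for i
  proof (cases "i = 0")
    case True
    then show ?thesis using empty by simp
  next
    case False
    let ?P = "\<epsilon> ` {1..enum_pos \<epsilon> (\<eta> i)}"
    have P: "?P = {v. enum_pos \<epsilon> v \<le> enum_pos \<epsilon> (\<eta> i)}"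
      using mem_prefix_iff[OF e pos(2)] by blast
    have "\<eta> ` {1..i} = {v. f v \<le> f (\<eta> i)}"
      using False i by (intro sorted_prefix_inj[where f = f, OF h mono \<open>inj f\<close>]) auto
    \<comment> \<open>The sublevel sets of the key are the chain: below \<open>S\<close> they are
      cut out of \<open>S\<close> by a prefix, above it a prefix is joined to
      \<open>S\<close>.\<close>
    also have "\<dots> = (if \<eta> i \<in> S then S \<inter> ?P else S \<union> ?P)"
    proof -
      have "\<not> CARD('n) + enum_pos \<epsilon> v \<le> enum_pos \<epsilon> u"
        "enum_pos \<epsilon> u \<le> CARD('n) + enum_pos \<epsilon> v" for u v
        using pos(1)[of v] pos(2)[of u] by linarith+
      then show ?thesis unfolding P by (auto simp: f_def)
    qed
    finally show ?thesis
      using tight_Un_Int[OF w yc S tight[OF pos(2)]] by simp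
  qed
  ultimately show ?thesis
    using that h marginal_vector_eq_iff[OF h w0, of y] by blast
qed

text \<open>
  A down-set \<open>D\<close> of the common order is the union over \<open>v \<in> D\<close> of the smallest tight set
  containing \<open>v\<close>.
\<close>

lemma tight_downset:
  fixes w :: "('n::finite) setfun"
  assumes w: "w \<in> supermodular_games" and y: "y \<in> core w"
    and D: "\<And>u v. (u, v) \<in> common_order (marginal_fibre w y) \<Longrightarrow> v \<in> D \<Longrightarrow> u \<in> D"
  shows "D \<in> tightness_class w y"
proof -
  note w0 = supermodular_empty[OF w]
  define M where "M v = \<Inter>{T \<in> tightness_class w y. v \<in> T}" for v
  \<comment> \<open>The intersection of the empty family, hence the base of the induction for
    \<open>Inter\<close>.\<close>
  have UNIV_tight: "UNIV \<in> tightness_class w y"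
    using y by (simp add: core_def tightness_class_def)
  have Inter: "\<Inter>\<A> \<in> tightness_class w y" if "\<A> \<subseteq> tightness_class w y" for \<A>
    using finite[of \<A>] that
    by (induction rule: finite_induct) (use UNIV_tight tight_Un_Int[OF w y] in auto)
  have Union: "(\<Union>v\<in>E. M v) \<in> tightness_class w y" for E
    using finite[of E]
  proof (induction rule: finite_induct)
    case empty
    then show ?case by (simp add: tightness_class_def w0)
  next
    case (insert v E)
    have "M v \<in> tightness_class w y" unfolding M_def by (rule Inter) auto
    then show ?case using insert tight_Un_Int[OF w y] by simp
  qed
  \<comment> \<open>For every enumeration in the fibre, the prefix ending at \<open>v\<close> is a
    tight set containing \<open>v\<close>, so it contains \<open>u\<close>; thus \<open>u\<close>
    precedes \<open>v\<close> in all of them.\<close>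
  have "M v \<subseteq> D" if v: "v \<in> D" for v
  proof
    fix u assume u: "u \<in> M v"
    have "enum_le \<epsilon> u v" if "\<epsilon> \<in> marginal_fibre w y" for \<epsilon>
    proof -
      have e: "\<epsilon> \<in> enumerations" and "marginal_vector w \<epsilon> = y"
        using that by (auto simp: marginal_fibre_def)
      have pos: "enum_pos \<epsilon> v \<le> CARD('n)" using enum_pos_mem[OF e, of v] by simp
      then have "\<epsilon> ` {1..enum_pos \<epsilon> v} \<in> tightness_class w y"
        using marginal_vector_eq_iff[OF e w0, of y] \<open>marginal_vector w \<epsilon> = y\<close> by simp
      moreover have "v \<in> \<epsilon> ` {1..enum_pos \<epsilon> v}" by (simp add: mem_prefix_iff[OF e pos])
      ultimately have "u \<in> \<epsilon> ` {1..enum_pos \<epsilon> v}" using u unfolding M_def by blast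
      then show ?thesis by (simp add: mem_prefix_iff[OF e pos] enum_le_def)
    qed
    then show "u \<in> D" using D[OF _ v] by (simp add: common_order_def)
  qed
  moreover have "v \<in> M v" for v by (auto simp: M_def)
  ultimately have "(\<Union>v\<in>D. M v) = D" by blast
  then show ?thesis using Union[of D] by simp
qed

section \<open>Local supermodularity and faces of the cone\<close>

lemma Delta_nonneg:
  assumes w: "w \<in> supermodular_games" and t: "(a, b, C) \<in> elementary_triplets"
  shows "0 \<le> Delta w a b C"
proof -
  have "insert a C \<union> insert b C = C \<union> {a, b}" "insert a C \<inter> insert b C = C"
    using t by (auto simp: elementary_triplets_def)
  then show ?thesis
    using supermodularD[OF w, of "insert a C" "insert b C"] by (simp add: Delta_def)
qed

text \<open>From local to global: contributions of single elements are first shown to grow with the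
  set by enlarging it one element at a time, then summed over the elements of a whole set.\<close>

lemma supermodular_if_Delta_nonneg:
  fixes w :: "('n::finite) setfun"
  assumes w0: "w $ {} = 0"
    and D: "\<And>a b C. (a, b, C) \<in> elementary_triplets \<Longrightarrow> 0 \<le> Delta w a b C"
  shows "w \<in> supermodular_games"
proof -
  have incr: "w $ insert a C - w $ C \<le> w $ insert a (C \<union> F) - w $ (C \<union> F)"
    if "a \<notin> C \<union> F" for a C F
    using finite[of F] that
  proof (induction F rule: finite_induct)
    case empty
    then show ?case by simp
  next
    case (insert b F)
    show ?case
    proof (cases "b \<in> C")
      case True
      then show ?thesis using insert by (simp add: insert_absorb)
    next
      case False
      then have "(a, b, C \<union> F) \<in> elementary_triplets"
        using insert by (auto simp: elementary_triplets_def)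
      from D[OF this] show ?thesis using insert by (simp add: Delta_def insert_commute)
    qed
  qed
  \<comment> \<open>The case \<open>F = A - E\<close> is supermodularity for \<open>A\<close> and
    \<open>E\<close>; the elements of \<open>F\<close> are added one by one using
    \<open>incr\<close>.\<close>
  have "w $ (A \<inter> E \<union> F) - w $ (A \<inter> E) \<le> w $ (E \<union> F) - w $ E" if "F \<subseteq> A - E" for A E F
    using finite[of F] that
  proof (induction F rule: finite_induct)
    case empty
    then show ?case by simp
  next
    case (insert a F)
    have "w $ insert a (A \<inter> E \<union> F) - w $ (A \<inter> E \<union> F)
        \<le> w $ insert a ((A \<inter> E \<union> F) \<union> E) - w $ ((A \<inter> E \<union> F) \<union> E)"
      using insert by (intro incr) auto
    moreover have "(A \<inter> E \<union> F) \<union> E = E \<union> F" by auto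
    ultimately show ?case using insert by simp
  qed
  note main = this
  have "w $ A + w $ E \<le> w $ (A \<union> E) + w $ (A \<inter> E)" for A E
    using main[of "A - E" A E] by (simp add: Un_Diff_Int Int_Diff_Un Un_commute)
  then show ?thesis using w0 by (simp add: supermodular_games_def)
qed

lemma Delta_linear:
  "Delta (s *\<^sub>R v + t *\<^sub>R w) a b C = s * Delta v a b C + t * Delta w a b C"
  by (simp add: Delta_def algebra_simps)

lemma convex_supermodular: "convex (supermodular_games :: ('n::finite) setfun set)"
proof (rule convexI)
  fix v w :: "'n setfun" and s t :: real
  assume v: "v \<in> supermodular_games" and w: "w \<in> supermodular_games"
    and "0 \<le> s" "0 \<le> t" "s + t = 1"
  then show "s *\<^sub>R v + t *\<^sub>R w \<in> supermodular_games"
    using supermodular_empty[OF v] supermodular_empty[OF w] Delta_nonneg[OF v] Delta_nonneg[OF w]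
    by (intro supermodular_if_Delta_nonneg) (auto simp: Delta_linear)
qed

text \<open>The zero set of a linear functional that is nonnegative on the cone.\<close>

lemma Delta_zero_face:
  assumes t: "(a, b, C) \<in> elementary_triplets"
  shows "{w \<in> supermodular_games. Delta w a b C = 0} face_of supermodular_games"
  unfolding face_of_def
proof (intro conjI ballI impI)
  show "convex {w \<in> supermodular_games. Delta w a b C = 0}"
    by (rule convexI) (auto simp: Delta_linear intro: convexD[OF convex_supermodular])
  fix v w x
  assume v: "v \<in> supermodular_games" and w: "w \<in> supermodular_games"
    and x: "x \<in> {w \<in> supermodular_games. Delta w a b C = 0}" and seg: "x \<in> open_segment v w"
  then obtain s where s: "0 < s" "s < 1" "x = (1 - s) *\<^sub>R v + s *\<^sub>R w" by (auto simp: in_segment)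
  have "(1 - s) * Delta v a b C + s * Delta w a b C = 0" using x s(3) by (simp add: Delta_linear)
  moreover have "0 \<le> (1 - s) * Delta v a b C" "0 \<le> s * Delta w a b C"
    using s Delta_nonneg[OF v t] Delta_nonneg[OF w t] by simp_all
  ultimately have "(1 - s) * Delta v a b C = 0" "s * Delta w a b C = 0" by linarith+
  then show "v \<in> {w \<in> supermodular_games. Delta w a b C = 0}"
    "w \<in> {w \<in> supermodular_games. Delta w a b C = 0}" using s v w by auto
qed auto

text \<open>Each equation satisfied by \<open>r\<close> cuts out a face containing \<open>r\<close>,
  which therefore contains the smallest faces of \<open>r\<close> and of \<open>m\<close>.\<close>

lemma independence_if_face_subset:
  assumes m: "m \<in> supermodular_games"
    and r: "r \<in> supermodular_games"
    and F: "smallest_face supermodular_games m \<subseteq> smallest_face supermodular_games r"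
  shows "independence_structure r \<subseteq> independence_structure m"
proof (clarsimp simp: independence_structure_def)
  fix a b C
  assume t: "(a, b, C) \<in> elementary_triplets" and "Delta r a b C = 0"
  then have "smallest_face supermodular_games r \<subseteq> {w \<in> supermodular_games. Delta w a b C = 0}"
    using Delta_zero_face[OF t] r by (auto simp: smallest_face_def)
  moreover have "m \<in> smallest_face supermodular_games m" by (auto simp: smallest_face_def)
  ultimately show "Delta m a b C = 0" using F by auto
qed

text \<open>
  The witness lies on the ray from \<open>m\<close> through \<open>r\<close>, slightly beyond \<open>r\<close>: only the
  finitely many triplets with \<open>Delta r a b C > 0\<close> limit how far.
\<close>

lemma open_segment_if_independence:
  fixes m r :: "('n::finite) setfun"
  assumes m: "m \<in> supermodular_games" and r: "r \<in> supermodular_games"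
    and I: "independence_structure r \<subseteq> independence_structure m"
  shows "m = r \<or> (\<exists>q\<in>supermodular_games. r \<in> open_segment m q)"
proof (intro disjCI)
  assume "\<not> (\<exists>q\<in>supermodular_games. r \<in> open_segment m q)"
  then have contra: "\<And>q. q \<in> supermodular_games \<Longrightarrow> r \<notin> open_segment m q" by blast
  \<comment> \<open>The expression is \<open>Delta q a b C\<close> for the later witness
    \<open>q\<close>, as a function of the overshoot \<open>t\<close>.\<close>
  have "\<forall>x\<in>elementary_triplets. \<forall>\<^sub>F t in at_right 0.
      case x of (a, b, C) \<Rightarrow> 0 \<le> (1 + t) * Delta r a b C + (- t) * Delta m a b C"
  proof (clarify)
    fix a b C assume t: "(a, b, C) \<in> (elementary_triplets :: ('n \<times> 'n \<times> 'n set) set)"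
    show "\<forall>\<^sub>F t in at_right 0. 0 \<le> (1 + t) * Delta r a b C + (- t) * Delta m a b C"
    proof (cases "Delta r a b C = 0")
      \<comment> \<open>The inclusion of independence structures enters here: the expression is then
        identically zero.\<close>
      case True
      then have "Delta m a b C = 0" using I t by (auto simp: independence_structure_def)
      then show ?thesis using True by simp
    next
      case False
      then have "0 < Delta r a b C" using Delta_nonneg[OF r t] by simp
      moreover have "((\<lambda>t. (1 + t) * Delta r a b C + (- t) * Delta m a b C) \<longlongrightarrow>
          (1 + 0) * Delta r a b C + (- 0) * Delta m a b C) (at_right 0)"
        by (intro tendsto_intros)
      ultimately show ?thesis
        by (intro eventually_mono[OF order_tendstoD(1)]) auto
    qed
  qed
  then have "\<forall>\<^sub>F t in at_right 0. \<forall>x\<in>elementary_triplets.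
      case x of (a, b, C) \<Rightarrow> 0 \<le> (1 + t) * Delta r a b C + (- t) * Delta m a b C"
    by (intro eventually_ball_finite) auto
  moreover have "\<forall>\<^sub>F t in at_right (0::real). 0 < t" by (rule eventually_at_right_less)
  ultimately have "\<forall>\<^sub>F t in at_right 0. 0 < t \<and> (\<forall>x\<in>elementary_triplets.
      case x of (a, b, C) \<Rightarrow> 0 \<le> (1 + t) * Delta r a b C + (- t) * Delta m a b C)"
    by (simp add: eventually_conj)
  then have "\<exists>t>0. \<forall>x\<in>elementary_triplets.
      case x of (a, b, C) \<Rightarrow> 0 \<le> (1 + t) * Delta r a b C + (- t) * Delta m a b C"
    by (rule eventually_happens'[OF trivial_limit_at_right_real])
  then obtain t where t: "0 < t" "\<And>a b C. (a, b, C) \<in> elementary_triplets \<Longrightarrow>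
      0 \<le> (1 + t) * Delta r a b C + (- t) * Delta m a b C"
    by blast
  define q where "q = (1 + t) *\<^sub>R r + (- t) *\<^sub>R m"
  have "q \<in> supermodular_games"
  proof (rule supermodular_if_Delta_nonneg)
    show "q $ {} = 0" using supermodular_empty[OF m] supermodular_empty[OF r] by (simp add: q_def)
    show "0 \<le> Delta q a b C" if "(a, b, C) \<in> elementary_triplets" for a b C
      unfolding q_def Delta_linear using t(2)[OF that] .
  qed
  then have nin: "r \<notin> open_segment m q" by (rule contra)
  \<comment> \<open>The parameter at which \<open>r\<close> sits between \<open>m\<close> and
    \<open>q\<close>.\<close>
  define s where "s = 1 / (1 + t)"
  have s: "0 < s" "s < 1" "s * (1 + t) = 1" "1 - s = s * t"
    using t(1) by (auto simp: s_def field_simps)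
  have "s *\<^sub>R q = (s * (1 + t)) *\<^sub>R r - (s * t) *\<^sub>R m"
    by (simp add: q_def scaleR_right_distrib scaleR_right_diff_distrib)
  then have "r = (1 - s) *\<^sub>R m + s *\<^sub>R q" unfolding s(3,4) by simp
  \<comment> \<open>As \<open>r\<close> has the form of a point of the open segment, only coinciding
    endpoints can exclude it.\<close>
  then have "m = q" using nin s(1,2) unfolding in_segment by blast
  then have "(1 + t) *\<^sub>R m = (1 + t) *\<^sub>R r" by (simp add: q_def algebra_simps)
  then show "m = r" using t(1) by simp
qed

text \<open>A face containing an inner point of a segment of the cone contains its
  endpoints.\<close>

lemma face_subset_if_open_segment:
  assumes m: "m \<in> supermodular_games"
    and seg: "m = r \<or> (\<exists>q\<in>supermodular_games. r \<in> open_segment m q)"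
  shows "smallest_face supermodular_games m \<subseteq> smallest_face supermodular_games r"
proof -
  have "m \<in> F" if "F face_of supermodular_games" "r \<in> F" for F
    using seg that m unfolding face_of_def by blast
  then show ?thesis by (auto simp: smallest_face_def)
qed

section \<open>Minkowski decompositions and normal fans of cores\<close>

text \<open>Marginal vectors of the combination are combinations of marginal vectors, and their hull
  contains its core; the other inclusion adds the defining inequalities.\<close>

lemma core_scaled_sum:
  assumes v: "v \<in> supermodular_games" and w: "w \<in> supermodular_games"
    and s: "0 \<le> s" and t: "0 \<le> t"
    and u: "s *\<^sub>R v + t *\<^sub>R w \<in> supermodular_games"
  shows "core (s *\<^sub>R v + t *\<^sub>R w) = ((*\<^sub>R) s ` core v) + ((*\<^sub>R) t ` core w)"
proof
  have "marginal_vector (s *\<^sub>R v + t *\<^sub>R w) \<epsilon> \<in> ((*\<^sub>R) s ` core v) + ((*\<^sub>R) t ` core w)"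
    if "\<epsilon> \<in> enumerations" for \<epsilon>
    unfolding marginal_vector_linear
    using marginal_vector_in_core[OF v that] marginal_vector_in_core[OF w that]
    by (intro set_plus_intro imageI)
  moreover have "convex (((*\<^sub>R) s ` core v) + ((*\<^sub>R) t ` core w))"
    by (intro convex_set_plus convex_scaling convex_core)
  ultimately have "convex hull (marginal_vector (s *\<^sub>R v + t *\<^sub>R w) ` enumerations)
      \<subseteq> ((*\<^sub>R) s ` core v) + ((*\<^sub>R) t ` core w)"
    by (intro hull_minimal) auto
  then show "core (s *\<^sub>R v + t *\<^sub>R w) \<subseteq> ((*\<^sub>R) s ` core v) + ((*\<^sub>R) t ` core w)"
    using core_subset_hull[OF u] by blast
  show "((*\<^sub>R) s ` core v) + ((*\<^sub>R) t ` core w) \<subseteq> core (s *\<^sub>R v + t *\<^sub>R w)"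
    using s t by (auto simp: set_plus_def core_def sum.distrib sum_distrib_left[symmetric]
        intro!: add_mono mult_left_mono)
qed

lemma Minkowski_if_open_segment:
  assumes m: "m \<in> supermodular_games" and r: "r \<in> supermodular_games"
    and seg: "m = r \<or> (\<exists>q\<in>supermodular_games. r \<in> open_segment m q)"
  shows "\<exists>q\<in>supermodular_games. \<exists>\<alpha>::real. 0 < \<alpha> \<and> \<alpha> < 1 \<and>
    core r = ((*\<^sub>R) (1 - \<alpha>) ` core m) + ((*\<^sub>R) \<alpha> ` core q)"
proof -
  obtain q \<alpha> where q: "q \<in> supermodular_games" and "0 < \<alpha>" "\<alpha> < 1"
    and eq: "r = (1 - \<alpha>) *\<^sub>R m + \<alpha> *\<^sub>R q"
  proof (cases "m = r")
    case True
    then have "r = (1 - 1/2) *\<^sub>R m + (1/2) *\<^sub>R m" by (simp add: scaleR_left_distrib[symmetric])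
    then show ?thesis using that[OF m, of "1/2"] by simp
  next
    case False
    then show ?thesis using seg that by (auto simp: in_segment)
  qed
  then have "core r = ((*\<^sub>R) (1 - \<alpha>) ` core m) + ((*\<^sub>R) \<alpha> ` core q)"
    using core_scaled_sum[OF m q, of "1 - \<alpha>" \<alpha>] r by simp
  then show ?thesis using q \<open>0 < \<alpha>\<close> \<open>\<alpha> < 1\<close> by blast
qed

text \<open>A direction maximised over the sum at \<open>s *\<^sub>R a + t *\<^sub>R b\<close> is
  maximised over \<open>A\<close> at \<open>a\<close>: let the first summand vary while
  \<open>b\<close> is kept fixed.\<close>

lemma normal_fan_Minkowski_refines:
  fixes A B :: "'a::real_inner set"
  assumes s: "0 < s" and K: "K \<in> normal_fan (((*\<^sub>R) s ` A) + ((*\<^sub>R) t ` B))"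
  shows "\<exists>L\<in>normal_fan A. K \<subseteq> L"
proof -
  let ?P = "((*\<^sub>R) s ` A) + ((*\<^sub>R) t ` B)"
  obtain a b where a: "a \<in> A" and b: "b \<in> B" and K_eq: "K = normal_cone ?P (s *\<^sub>R a + t *\<^sub>R b)"
    using K by (auto simp: normal_fan_def elim!: set_plus_elim)
  have "K \<subseteq> normal_cone A a"
  proof (unfold K_eq normal_cone_def, intro subsetI CollectI ballI)
    fix x z
    assume x: "x \<in> {x. \<forall>z\<in>?P. 0 \<le> x \<bullet> (s *\<^sub>R a + t *\<^sub>R b - z)}" and z: "z \<in> A"
    have "s *\<^sub>R z + t *\<^sub>R b \<in> ?P" using z b by (intro set_plus_intro imageI)
    then have "0 \<le> x \<bullet> (s *\<^sub>R a + t *\<^sub>R b - (s *\<^sub>R z + t *\<^sub>R b))" using x by blast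
    then have "0 \<le> s * (x \<bullet> (a - z))" by (simp add: inner_diff_right inner_add_right right_diff_distrib)
    then show "0 \<le> x \<bullet> (a - z)" using s by (simp add: zero_le_mult_iff)
  qed
  then show ?thesis using a by (auto simp: normal_fan_def)
qed

text \<open>
  The direction \<open>x\<close> is minus the sum of the indicators of all prefixes of \<open>\<epsilon>\<close>, so that
  \<open>x \<bullet> z\<close> is maximal over the core exactly when every prefix is tight at \<open>z\<close>.
\<close>

lemma separating_direction:
  fixes \<epsilon> :: "nat \<Rightarrow> 'n::finite"
  assumes e: "\<epsilon> \<in> enumerations"
  obtains x :: "real ^ 'n" where "\<And>(w :: 'n setfun) y. w \<in> supermodular_games \<Longrightarrow> y \<in> core w \<Longrightarrow>
    x \<in> normal_cone (core w) y \<longleftrightarrow> y = marginal_vector w \<epsilon>"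
proof
  \<comment> \<open>Built from \<open>\<epsilon>\<close> alone, so that the same direction serves
    the cores of both \<open>r\<close> and \<open>m\<close>.\<close>
  define x :: "real ^ 'n" where
    "x = - (\<Sum>i\<in>{..CARD('n)}. \<chi> u. if u \<in> \<epsilon> ` {1..i} then 1 else 0)"
  fix w :: "'n setfun" and y
  assume w: "w \<in> supermodular_games" and y: "y \<in> core w"
  let ?m = "marginal_vector w \<epsilon>"
  have ind: "(\<chi> u. if u \<in> S then 1 else 0) \<bullet> z = (\<Sum>l\<in>S. z $ l)" for S and z :: "real ^ 'n"
    by (simp add: inner_vec_def if_distrib[of "\<lambda>t. t * _"] sum.If_cases)
  have x: "x \<bullet> z = - (\<Sum>i\<in>{..CARD('n)}. \<Sum>l\<in>\<epsilon> ` {1..i}. z $ l)" for z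
    unfolding x_def by (simp only: inner_minus_left inner_sum_left ind)
  have xm: "x \<bullet> ?m = - (\<Sum>i\<in>{..CARD('n)}. w $ (\<epsilon> ` {1..i}))"
    unfolding x by (simp add: sum_marginal_prefix[OF e supermodular_empty[OF w]])
  have bound: "x \<bullet> z \<le> x \<bullet> ?m" if "z \<in> core w" for z
    unfolding xm unfolding x neg_le_iff_le by (intro sum_mono coreD that)
  show "x \<in> normal_cone (core w) y \<longleftrightarrow> y = ?m"
  proof
    assume "y = ?m"
    then show "x \<in> normal_cone (core w) y"
      using bound by (simp add: normal_cone_def inner_diff_right)
  next
    assume "x \<in> normal_cone (core w) y"
    then have "x \<bullet> ?m \<le> x \<bullet> y"
      using marginal_vector_in_core[OF w e] by (simp add: normal_cone_def inner_diff_right)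
    then have le: "(\<Sum>i\<in>{..CARD('n)}. \<Sum>l\<in>\<epsilon> ` {1..i}. y $ l) \<le> (\<Sum>i\<in>{..CARD('n)}. w $ (\<epsilon> ` {1..i}))"
      unfolding xm unfolding x by simp
    have "\<epsilon> ` {1..i} \<in> tightness_class w y" if "i \<le> CARD('n)" for i
    proof (rule ccontr)
      assume "\<epsilon> ` {1..i} \<notin> tightness_class w y"
      then have "w $ (\<epsilon> ` {1..i}) < (\<Sum>l\<in>\<epsilon> ` {1..i}. y $ l)"
        using coreD[OF y, of "\<epsilon> ` {1..i}"] by (simp add: tightness_class_def)
      then have "(\<Sum>i\<in>{..CARD('n)}. w $ (\<epsilon> ` {1..i})) < (\<Sum>i\<in>{..CARD('n)}. \<Sum>l\<in>\<epsilon> ` {1..i}. y $ l)"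
        using that coreD[OF y] by (intro sum_strict_mono_ex1) auto
      then show False using le by simp
    qed
    then show "y = ?m" using marginal_vector_eq_iff[OF e supermodular_empty[OF w], of y] by simp
  qed
qed

section \<open>Refinement of enumeration partitions\<close>

text \<open>The pointwise form on the right is the common meeting point of the combinatorial
  conditions.\<close>

lemma partition_refines_iff:
  assumes m: "m \<in> supermodular_games" and r: "r \<in> supermodular_games"
  shows "(\<forall>S\<in>enumeration_partition r. \<exists>T\<in>enumeration_partition m. S \<subseteq> T) \<longleftrightarrow>
    (\<forall>\<epsilon>\<in>enumerations. \<forall>\<eta>\<in>enumerations. marginal_vector r \<epsilon> = marginal_vector r \<eta> \<longrightarrow>
      marginal_vector m \<epsilon> = marginal_vector m \<eta>)" (is "?L \<longleftrightarrow> ?R")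
proof -
  have "?L \<longleftrightarrow> (\<forall>\<epsilon>\<in>enumerations. \<exists>\<zeta>\<in>enumerations. \<forall>\<eta>\<in>enumerations.
      marginal_vector r \<eta> = marginal_vector r \<epsilon> \<longrightarrow> marginal_vector m \<eta> = marginal_vector m \<zeta>)"
    unfolding enumeration_partition_def vertices_core[OF m] vertices_core[OF r] ball_simps bex_simps
      marginal_fibre_def by blast
  \<comment> \<open>Taking \<open>\<epsilon>\<close> for \<open>\<eta>\<close> shows that the block
    of \<open>\<zeta>\<close> is that of \<open>\<epsilon>\<close>.\<close>
  also have "\<dots> \<longleftrightarrow> ?R" by metis
  finally show ?thesis .
qed

text \<open>The normal cone at the common vertex of \<open>core r\<close> contains the separating
  directions of both enumerations. It lies in one normal cone of \<open>core m\<close>, whose base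
  point must then be the marginal vector of either.\<close>

lemma partition_refines_if_normal_fan_refines:
  assumes m: "m \<in> supermodular_games" and r: "r \<in> supermodular_games"
    and N: "\<forall>K\<in>normal_fan (core r). \<exists>L\<in>normal_fan (core m). K \<subseteq> L"
    and e: "\<epsilon> \<in> enumerations" and h: "\<eta> \<in> enumerations"
    and eq: "marginal_vector r \<epsilon> = marginal_vector r \<eta>"
  shows "marginal_vector m \<epsilon> = marginal_vector m \<eta>"
proof -
  have "normal_cone (core r) (marginal_vector r \<epsilon>) \<in> normal_fan (core r)"
    unfolding normal_fan_def by (intro imageI marginal_vector_in_core r e)
  then obtain y where y: "y \<in> core m"
    and sub: "normal_cone (core r) (marginal_vector r \<epsilon>) \<subseteq> normal_cone (core m) y"
    using N unfolding normal_fan_def by blast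
  have "y = marginal_vector m \<zeta>"
    if z: "\<zeta> \<in> enumerations" and "marginal_vector r \<epsilon> = marginal_vector r \<zeta>" for \<zeta>
  proof -
    obtain x where x: "\<And>w y. w \<in> supermodular_games \<Longrightarrow> y \<in> core w \<Longrightarrow>
        x \<in> normal_cone (core w) y \<longleftrightarrow> y = marginal_vector w \<zeta>"
      using separating_direction[OF z] by blast
    have "x \<in> normal_cone (core r) (marginal_vector r \<epsilon>)"
      using x[OF r marginal_vector_in_core[OF r e]] that by simp
    then show ?thesis using sub x[OF m y] by blast
  qed
  from this[OF e refl] this[OF h eq] show ?thesis by simp
qed

text \<open>Forwards, the prefixes of all enumerations in a fibre of \<open>r\<close> become tight
  at one vertex for \<open>m\<close>. Backwards, every tight set is a prefix of some enumeration in
  the same fibre.\<close>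

lemma tightness_refines_iff:
  fixes m r :: "('n::finite) setfun"
  assumes m: "m \<in> supermodular_games" and r: "r \<in> supermodular_games"
  shows "(\<forall>T\<in>tightness_structure r. \<exists>S\<in>tightness_structure m. T \<subseteq> S) \<longleftrightarrow>
    (\<forall>\<epsilon>\<in>enumerations. \<forall>\<eta>\<in>enumerations. marginal_vector r \<epsilon> = marginal_vector r \<eta> \<longrightarrow>
      marginal_vector m \<epsilon> = marginal_vector m \<eta>)" (is "?L \<longleftrightarrow> ?R")
proof
  assume L: ?L
  show ?R
  proof (intro ballI impI)
    fix \<epsilon> \<eta>
    assume e: "\<epsilon> \<in> enumerations" and h: "\<eta> \<in> enumerations"
      and eq: "marginal_vector r \<epsilon> = marginal_vector r \<eta>"
    obtain y where "tightness_class r (marginal_vector r \<epsilon>) \<subseteq> tightness_class m y"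
      using L e unfolding tightness_structure_def vertices_core[OF r] by blast
    then have "marginal_vector m \<zeta> = y"
      if "\<zeta> \<in> enumerations" "marginal_vector r \<zeta> = marginal_vector r \<epsilon>" for \<zeta>
      using marginal_vector_eq_iff[OF that(1) supermodular_empty[OF r]]
        marginal_vector_eq_iff[OF that(1) supermodular_empty[OF m]] that(2) by blast
    from this[OF e refl] this[OF h eq[symmetric]]
    show "marginal_vector m \<epsilon> = marginal_vector m \<eta>" by simp
  qed
next
  assume R: ?R
  show ?L
    unfolding tightness_structure_def vertices_core[OF r] vertices_core[OF m]
  proof (clarify)
    fix \<epsilon> :: "nat \<Rightarrow> 'n" assume e: "\<epsilon> \<in> enumerations"
    have "S \<in> tightness_class m (marginal_vector m \<epsilon>)"
      if S: "S \<in> tightness_class r (marginal_vector r \<epsilon>)" for S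
    proof -
      obtain \<eta> where h: "\<eta> \<in> enumerations" "marginal_vector r \<eta> = marginal_vector r \<epsilon>"
        and pre: "\<eta> ` {1..card S} = S"
        using tight_set_is_prefix[OF r e refl S] by blast
      then have "marginal_vector m \<eta> = marginal_vector m \<epsilon>" using R e by blast
      then have "\<eta> ` {1..card S} \<in> tightness_class m (marginal_vector m \<epsilon>)"
        using marginal_vector_eq_iff[OF h(1) supermodular_empty[OF m]]
        by (simp add: card_mono)
      then show ?thesis using pre by simp
    qed
    then show "\<exists>S\<in>tightness_class m ` marginal_vector m ` enumerations.
        tightness_class r (marginal_vector r \<epsilon>) \<subseteq> S"
      using e by blast
  qed
qed

text \<open>Forwards, a prefix is a down-set of the poset of \<open>r\<close>, hence of the sparser
  poset of \<open>m\<close>, hence tight for \<open>m\<close>. Backwards, a larger fibre has a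
  smaller common order.\<close>

lemma fan_of_posets_sparser_iff:
  fixes m r :: "('n::finite) setfun"
  assumes m: "m \<in> supermodular_games" and r: "r \<in> supermodular_games"
  shows "(\<forall>R\<in>fan_of_posets r. \<exists>Q\<in>fan_of_posets m. Q \<subseteq> R) \<longleftrightarrow>
    (\<forall>\<epsilon>\<in>enumerations. \<forall>\<eta>\<in>enumerations. marginal_vector r \<epsilon> = marginal_vector r \<eta> \<longrightarrow>
      marginal_vector m \<epsilon> = marginal_vector m \<eta>)" (is "?L \<longleftrightarrow> ?R")
proof
  assume L: ?L
  show ?R
  proof (intro ballI impI)
    fix \<epsilon> \<eta>
    assume e: "\<epsilon> \<in> enumerations" and h: "\<eta> \<in> enumerations"
      and eq: "marginal_vector r \<epsilon> = marginal_vector r \<eta>"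
    obtain y where y: "y \<in> vertices (core m)"
      and sub: "common_order (marginal_fibre m y)
        \<subseteq> common_order (marginal_fibre r (marginal_vector r \<epsilon>))"
      using L e unfolding fan_of_posets_def vertices_core[OF r] by blast
    have yc: "y \<in> core m" using y by (simp add: vertices_def extreme_point_of_def)
    have "marginal_vector m \<zeta> = y"
      if z: "\<zeta> \<in> enumerations" and zeq: "marginal_vector r \<zeta> = marginal_vector r \<epsilon>" for \<zeta>
      unfolding marginal_vector_eq_iff[OF z supermodular_empty[OF m]]
    proof (intro allI impI)
      fix i assume i: "i \<le> CARD('n)"
      show "\<zeta> ` {1..i} \<in> tightness_class m y"
      proof (rule tight_downset[OF m yc])
        fix u v assume "(u, v) \<in> common_order (marginal_fibre m y)" and v: "v \<in> \<zeta> ` {1..i}"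
        then have "enum_le \<zeta> u v"
          using sub z zeq by (auto simp: common_order_def marginal_fibre_def)
        then show "u \<in> \<zeta> ` {1..i}" using v by (simp add: mem_prefix_iff[OF z i] enum_le_def)
      qed
    qed
    from this[OF e refl] this[OF h eq[symmetric]]
    show "marginal_vector m \<epsilon> = marginal_vector m \<eta>" by simp
  qed
next
  assume R: ?R
  show ?L
    unfolding fan_of_posets_def vertices_core[OF r] vertices_core[OF m]
  proof (clarify)
    fix \<epsilon> :: "nat \<Rightarrow> 'n" assume e: "\<epsilon> \<in> enumerations"
    have "marginal_fibre r (marginal_vector r \<epsilon>) \<subseteq> marginal_fibre m (marginal_vector m \<epsilon>)"
      using R e unfolding marginal_fibre_def by blast
    then have "common_order (marginal_fibre m (marginal_vector m \<epsilon>))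
        \<subseteq> common_order (marginal_fibre r (marginal_vector r \<epsilon>))"
      by (auto simp: common_order_def)
    then show "\<exists>Q\<in>(\<lambda>y. common_order (marginal_fibre m y)) ` marginal_vector m ` enumerations.
        Q \<subseteq> common_order (marginal_fibre r (marginal_vector r \<epsilon>))"
      using e by blast
  qed
qed

section \<open>Permutohedral subgraphs and elementary triplets\<close>

lemma permutohedral_adjacent_iff:
  assumes "\<epsilon> \<in> enumerations" "\<eta> \<in> enumerations" "w \<in> supermodular_games"
  shows "permutohedral_adjacent w \<epsilon> \<eta> \<longleftrightarrow>
    (\<exists>i. swapped_at i \<epsilon> \<eta>) \<and> marginal_vector w \<epsilon> = marginal_vector w \<eta>"
proof -
  have "permutohedral_adjacent w \<epsilon> \<eta> \<longleftrightarrow>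
      (\<exists>i. swapped_at i \<epsilon> \<eta> \<and> Delta w (\<epsilon> i) (\<epsilon> (i + 1)) (\<epsilon> ` {1..<i}) = 0)"
    by (simp add: permutohedral_adjacent_def swapped_at_def)
  then show ?thesis
    using marginal_vector_swapped_iff[OF assms(1,2) supermodular_empty[OF assms(3)]] by blast
qed

lemma subgraph_if_partition_refines:
  assumes m: "m \<in> supermodular_games" and r: "r \<in> supermodular_games"
    and R: "\<forall>\<epsilon>\<in>enumerations. \<forall>\<eta>\<in>enumerations. marginal_vector r \<epsilon> = marginal_vector r \<eta> \<longrightarrow>
      marginal_vector m \<epsilon> = marginal_vector m \<eta>"
  shows "is_subgraph (permutohedral_subgraph r) (permutohedral_subgraph m)"
proof -
  have "permutohedral_adjacent m \<epsilon> \<eta>"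
    if "\<epsilon> \<in> enumerations" "\<eta> \<in> enumerations" "permutohedral_adjacent r \<epsilon> \<eta>" for \<epsilon> \<eta>
    using that R permutohedral_adjacent_iff[OF that(1,2) m] permutohedral_adjacent_iff[OF that(1,2) r]
    by blast
  then show ?thesis unfolding is_subgraph_def permutohedral_subgraph_def by fastforce
qed

text \<open>Every triplet labels an edge of the permutohedron, so subgraphs determine independence
  structures.\<close>

lemma triplet_enumerations:
  fixes a b :: "'n::finite"
  assumes t: "(a, b, C) \<in> elementary_triplets"
  obtains \<epsilon> \<eta> i where "\<epsilon> \<in> enumerations" "\<eta> \<in> enumerations" "swapped_at i \<epsilon> \<eta>"
    "\<epsilon> i = a" "\<epsilon> (i + 1) = b" "\<epsilon> ` {1..<i} = C"
proof -
  have ab: "a \<noteq> b" "a \<notin> C" "b \<notin> C" using t by (auto simp: elementary_triplets_def)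
  \<comment> \<open>Sorting lists \<open>C\<close>, then \<open>a\<close>, then \<open>b\<close>,
    then the rest; the three nested prefixes identify the entries after \<open>C\<close>.\<close>
  define f :: "'n \<Rightarrow> nat" where
    "f u = (if u \<in> C then 0 else if u = a then 1 else if u = b then 2 else 3)" for u
  obtain \<epsilon> where e: "\<epsilon> \<in> enumerations"
    and mono: "\<And>i j. 1 \<le> i \<Longrightarrow> i \<le> j \<Longrightarrow> j \<le> CARD('n) \<Longrightarrow> f (\<epsilon> i) \<le> f (\<epsilon> j)"
    using sorted_enumeration_exists[of f] by blast
  let ?k = "card C"
  have c1: "card (insert a C) = Suc ?k" and c2: "card (insert b (insert a C)) = Suc (Suc ?k)"
    using ab by auto
  have le: "Suc (Suc ?k) \<le> CARD('n)" unfolding c2[symmetric] by (rule card_mono) auto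
  have p0: "\<epsilon> ` {1..?k} = C"
    by (rule sorted_prefix_eq[where f = f, OF e mono]) (auto simp: f_def)
  have p1: "\<epsilon> ` {1..Suc ?k} = insert a C"
    unfolding c1[symmetric]
    by (rule sorted_prefix_eq[where f = f, OF e mono]) (use ab in \<open>auto simp: f_def\<close>)
  have p2: "\<epsilon> ` {1..Suc (Suc ?k)} = insert b (insert a C)"
    unfolding c2[symmetric]
    by (rule sorted_prefix_eq[where f = f, OF e mono]) (use ab in \<open>auto simp: f_def\<close>)
  have "\<epsilon> (Suc ?k) \<notin> C" using prefix_Suc_notin[OF e, of ?k] le p0 by simp
  moreover have "\<epsilon> (Suc ?k) \<in> insert a C" unfolding p1[symmetric] by (rule imageI) simp
  ultimately have ea: "\<epsilon> (Suc ?k) = a" by simp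
  have "\<epsilon> (Suc (Suc ?k)) \<notin> insert a C"
    using prefix_Suc_notin[OF e, of "Suc ?k"] le p1 by simp
  moreover have "\<epsilon> (Suc (Suc ?k)) \<in> insert b (insert a C)"
    unfolding p2[symmetric] by (rule imageI) simp
  ultimately have eb: "\<epsilon> (Suc ?k + 1) = b" by (simp add: One_nat_def)
  obtain \<eta> where "\<eta> \<in> enumerations" "swapped_at (Suc ?k) \<epsilon> \<eta>"
    using swapped_exists[OF e, of "Suc ?k"] le by auto
  then show ?thesis
    using that e ea eb p0 by (simp add: atLeastLessThanSuc_atLeastAtMost)
qed

lemma independence_if_subgraph:
  fixes m r :: "('n::finite) setfun"
  assumes m: "m \<in> supermodular_games" and r: "r \<in> supermodular_games"
    and G: "is_subgraph (permutohedral_subgraph r) (permutohedral_subgraph m)"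
  shows "independence_structure r \<subseteq> independence_structure m"
proof (clarsimp simp: independence_structure_def)
  fix a b :: 'n and C
  assume t: "(a, b, C) \<in> elementary_triplets" and D: "Delta r a b C = 0"
  obtain \<epsilon> \<eta> i where e: "\<epsilon> \<in> enumerations" and h: "\<eta> \<in> enumerations" and s: "swapped_at i \<epsilon> \<eta>"
    and abC: "\<epsilon> i = a" "\<epsilon> (i + 1) = b" "\<epsilon> ` {1..<i} = C"
    using triplet_enumerations[OF t] by blast
  note iff = marginal_vector_swapped_iff[OF e h _ s, unfolded abC]
  have "marginal_vector r \<epsilon> = marginal_vector r \<eta>"
    using iff[OF supermodular_empty[OF r]] D by simp
  then have "permutohedral_adjacent r \<epsilon> \<eta>"
    using permutohedral_adjacent_iff[OF e h r] s by blast
  then have "{\<epsilon>, \<eta>} \<in> snd (permutohedral_subgraph r)"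
    using e h unfolding permutohedral_subgraph_def snd_conv mem_Collect_eq by blast
  then have "{\<epsilon>, \<eta>} \<in> snd (permutohedral_subgraph m)"
    using G unfolding is_subgraph_def by blast
  \<comment> \<open>An edge is unordered, so the pair may come back swapped; equality of marginal
    vectors is symmetric and survives this.\<close>
  then obtain \<epsilon>' \<eta>' where "{\<epsilon>, \<eta>} = {\<epsilon>', \<eta>'}" and e': "\<epsilon>' \<in> enumerations" "\<eta>' \<in> enumerations"
    and "permutohedral_adjacent m \<epsilon>' \<eta>'"
    unfolding permutohedral_subgraph_def snd_conv mem_Collect_eq by blast
  moreover from this have "marginal_vector m \<epsilon>' = marginal_vector m \<eta>'"
    using permutohedral_adjacent_iff[OF e' m] by simp
  ultimately have "marginal_vector m \<epsilon> = marginal_vector m \<eta>"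
    by (metis doubleton_eq_iff)
  then show "Delta m a b C = 0" using iff[OF supermodular_empty[OF m]] by simp
qed

theorem theorem17:
  fixes m r :: "('n::finite) setfun"
  assumes "m \<in> supermodular_games" and "r \<in> supermodular_games"
  shows
    "let
       cond_i = smallest_face supermodular_games m \<subseteq> smallest_face supermodular_games r;
       cond_ii = (m = r \<or> (\<exists>q\<in>supermodular_games. r \<in> open_segment m q));
       cond_iii = (\<exists>q\<in>supermodular_games. \<exists>\<alpha>::real. 0 < \<alpha> \<and> \<alpha> < 1 \<and>
         core r = ((*\<^sub>R) (1 - \<alpha>) ` core m) + ((*\<^sub>R) \<alpha> ` core q));
       cond_iv = (\<forall>K\<in>normal_fan (core r). \<exists>L\<in>normal_fan (core m). K \<subseteq> L);
       cond_v = (\<forall>S\<in>enumeration_partition r. \<exists>T\<in>enumeration_partition m. S \<subseteq> T);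
       cond_vi = (\<forall>T\<in>tightness_structure r. \<exists>S\<in>tightness_structure m. T \<subseteq> S);
       cond_vii = independence_structure r \<subseteq> independence_structure m;
       cond_viii = is_subgraph (permutohedral_subgraph r) (permutohedral_subgraph m);
       cond_ix = (\<forall>R\<in>fan_of_posets r. \<exists>Q\<in>fan_of_posets m. Q \<subseteq> R)
     in
       (cond_i \<longleftrightarrow> cond_ii) \<and> (cond_i \<longleftrightarrow> cond_iii) \<and> (cond_i \<longleftrightarrow> cond_iv) \<and>
       (cond_i \<longleftrightarrow> cond_v) \<and> (cond_i \<longleftrightarrow> cond_vi) \<and> (cond_i \<longleftrightarrow> cond_vii) \<and>
       (cond_i \<longleftrightarrow> cond_viii) \<and> (cond_i \<longleftrightarrow> cond_ix)"
proof -
  note m = assms(1) and r = assms(2)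
  let ?i = "smallest_face supermodular_games m \<subseteq> smallest_face supermodular_games r"
  let ?ii = "m = r \<or> (\<exists>q\<in>supermodular_games. r \<in> open_segment m q)"
  let ?iii = "\<exists>q\<in>supermodular_games. \<exists>\<alpha>::real. 0 < \<alpha> \<and> \<alpha> < 1 \<and>
    core r = ((*\<^sub>R) (1 - \<alpha>) ` core m) + ((*\<^sub>R) \<alpha> ` core q)"
  let ?iv = "\<forall>K\<in>normal_fan (core r). \<exists>L\<in>normal_fan (core m). K \<subseteq> L"
  let ?v = "\<forall>S\<in>enumeration_partition r. \<exists>T\<in>enumeration_partition m. S \<subseteq> T"
  let ?vi = "\<forall>T\<in>tightness_structure r. \<exists>S\<in>tightness_structure m. T \<subseteq> S"
  let ?vii = "independence_structure r \<subseteq> independence_structure m"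
  let ?viii = "is_subgraph (permutohedral_subgraph r) (permutohedral_subgraph m)"
  let ?ix = "\<forall>R\<in>fan_of_posets r. \<exists>Q\<in>fan_of_posets m. Q \<subseteq> R"
  \<comment> \<open>The implications form the cycles i, vii, ii, i and ii, iii, iv, v, viii, vii,
    ii; conditions vi and ix are attached to v.\<close>
  have 1: "?i \<Longrightarrow> ?vii" by (rule independence_if_face_subset[OF m r])
  have 2: "?vii \<Longrightarrow> ?ii" by (rule open_segment_if_independence[OF m r])
  have 3: "?ii \<Longrightarrow> ?i" by (rule face_subset_if_open_segment[OF m])
  have 4: "?ii \<Longrightarrow> ?iii" by (rule Minkowski_if_open_segment[OF m r])
  have 5: "?iii \<Longrightarrow> ?iv"
  proof -
    assume ?iii
    then obtain q \<alpha> where \<alpha>: "\<alpha> < 1"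
      and core: "core r = ((*\<^sub>R) (1 - \<alpha>) ` core m) + ((*\<^sub>R) \<alpha> ` core q)"
      by blast
    show ?iv
      unfolding core by (intro ballI normal_fan_Minkowski_refines[of "1 - \<alpha>"]) (use \<alpha> in simp)
  qed
  have 6: "?iv \<Longrightarrow> ?v"
    unfolding partition_refines_iff[OF m r]
    using partition_refines_if_normal_fan_refines[OF m r] by blast
  have 7: "?v \<Longrightarrow> ?viii"
    unfolding partition_refines_iff[OF m r] by (rule subgraph_if_partition_refines[OF m r])
  have 8: "?viii \<Longrightarrow> ?vii" by (rule independence_if_subgraph[OF m r])
  have 9: "?v \<longleftrightarrow> ?vi"
    unfolding partition_refines_iff[OF m r] tightness_refines_iff[OF m r] ..
  have 10: "?v \<longleftrightarrow> ?ix"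
    unfolding partition_refines_iff[OF m r] fan_of_posets_sparser_iff[OF m r] ..
  from 1 2 3 4 5 6 7 8 9 10 show ?thesis unfolding Let_def by argo
qed

end
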